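(* Let $\mathbb{T}$ be a 2-category with objects $\delta,\mu,\tau$ and 1-morphisms $\iota: \delta \to \mu$ and $d: \delta \to \tau$. Put $M = \mathbb{T}(\mu,\tau)$, $D = \mathbb{T}(\delta,\tau)$, and let $\mathrm{Inf} = \mathbb{T}(\iota,\tau): M \to D$ be the precomposition functor, $m \mapsto m\iota$. Let $S$ be a monoidal preorder whose identity 1-morphism $\mathrm{Id}_*$ is a bottom element, and let $\mathrm{Err}: D \to S$ be an $S$ flavoured error on the category $D$. If a left Kan extension $\mathrm{Lan}_\iota d$ of $d$ along $\iota$ exists in $\mathbb{T}$, then $\mathrm{Lan}_\iota d$ is a global error minimiser with respect to $d$; that is, for every object $m$ of $M$, $$\mathrm{Err}(d, \mathrm{Inf}(\mathrm{Lan}_\iota d)) \le_S \mathrm{Err}(d, \mathrm{Inf}(m)).$$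
   Context: 2-categories are strict: between any two objects $x,y$ there is a hom-category $\mathbb{T}(x,y)$, whose objects are the 1-morphisms $x \to y$ and whose morphisms are the 2-morphisms. For a 2-morphism $\alpha$ and a composable 1-morphism $G$, $\alpha\cdot G$ denotes whiskering. Left Kan extension in a 2-category: given 1-morphisms $K: C \to E$ and $G: C \to D'$, a left Kan extension of $K$ along $G$ is a 1-morphism $\mathrm{Lan}_G K: D' \to E$ together with a 2-morphism $\eta: K \Rightarrow (\mathrm{Lan}_G K)G$ such that for any other pair $(H: D' \to E,\ \gamma: K \Rightarrow HG)$ there exists a 2-morphism $\alpha: \mathrm{Lan}_G K \Rightarrow H$ with $\gamma = (\alpha\cdot G)\eta$. A monoidal preorder $S$ is a (strict) 2-category with a single object $*$ and at most one 2-morphism between any pair of 1-morphisms; equivalently, its 1-morphisms form a monoid with unit $\mathrm{Id}_*$, carrying a preorder ($a \le b$ iff there is a 2-morphism $a \Rightarrow b$) for which multiplication is monotone in both variables. A bottom element is an element $\bot$ with $\bot \le a$ for all $a$. Given a monoidal preorder $S$ in which $\mathrm{Id}_*$ is a bottom element, an $S$ flavoured error on a category $D$ is a lax 2-functor $\mathrm{Err}: D \to S$, where $D$ is regarded as a 2-category with only identity 2-morphisms. Concretely, it assigns to every morphism $f$ of $D$ a 1-morphism $\mathrm{Err}(f)$ of $S$ such that $\mathrm{Err}(g)\mathrm{Err}(f) \le \mathrm{Err}(gf)$ for composable $f,g$ and $\mathrm{Id}_* \le \mathrm{Err}(\mathrm{Id}_x)$ for every object $x$ (the coherence conditions are automatic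 since $S$ has at most one 2-morphism between 1-morphisms). Error comparison: for objects $x,y,z,w$ of $D$, the notation $\mathrm{Err}(x,y) \le_S \mathrm{Err}(z,w)$ means that for every morphism $f: z \to w$ in $D$ there exists a morphism $g: x \to y$ in $D$ and a 2-morphism $\mathrm{Err}(g) \Rightarrow \mathrm{Err}(f)$ in $S$ (i.e. $\mathrm{Err}(g) \le \mathrm{Err}(f)$). The symbol $\mathrm{Err}(x,y)$ by itself is only notation and not an element of $S$. An object $x$ of $M$ is a global error minimiser with respect to $d$ if $\mathrm{Err}(d,\mathrm{Inf}(x)) \le_S \mathrm{Err}(d,\mathrm{Inf}(m))$ for every object $m$ of $M$. *)

theory Defs
  imports Main
begin

record ('o, 'm) cat =
  Obj :: "'o set"
  Arr :: "'m set"
  Dom :: "'m \<Rightarrow> 'o"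
  Cod :: "'m \<Rightarrow> 'o"
  Ident :: "'o \<Rightarrow> 'm"
  Comp :: "'m \<Rightarrow> 'm \<Rightarrow> 'm"   (* Comp C g f is "g after f" *)

definition Hom :: "('o, 'm) cat \<Rightarrow> 'o \<Rightarrow> 'o \<Rightarrow> 'm set" where
  "Hom C x y = {f \<in> Arr C. Dom C f = x \<and> Cod C f = y}"

locale category =
  fixes C :: "('o, 'm) cat"
  assumes dom_obj: "f \<in> Arr C \<Longrightarrow> Dom C f \<in> Obj C"
    and cod_obj: "f \<in> Arr C \<Longrightarrow> Cod C f \<in> Obj C"
    and ident_hom: "x \<in> Obj C \<Longrightarrow> Ident C x \<in> Hom C x x"
    and comp_hom: "f \<in> Hom C x y \<Longrightarrow> g \<in> Hom C y z \<Longrightarrow> Comp C g f \<in> Hom C x z"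
    and comp_ident: "f \<in> Hom C x y \<Longrightarrow> Comp C f (Ident C x) = f"
    and ident_comp: "f \<in> Hom C x y \<Longrightarrow> Comp C (Ident C y) f = f"
    and comp_assoc: "f \<in> Hom C x y \<Longrightarrow> g \<in> Hom C y z \<Longrightarrow> h \<in> Hom C z w \<Longrightarrow>
      Comp C h (Comp C g f) = Comp C (Comp C h g) f"

record ('o, 'm, 'p, 'n) func =
  on_obj :: "'o \<Rightarrow> 'p"
  on_arr :: "'m \<Rightarrow> 'n"

locale is_functor =
  fixes A :: "('o, 'm) cat" and B :: "('p, 'n) cat" and F :: "('o, 'm, 'p, 'n) func"
  assumes source: "category A"
    and target: "category B"
    and on_obj: "x \<in> Obj A \<Longrightarrow> on_obj F x \<in> Obj B"
    and on_hom: "f \<in> Hom A x y \<Longrightarrow> on_arr F f \<in> Hom B (on_obj F x) (on_obj F y)"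
    and on_ident: "x \<in> Obj A \<Longrightarrow> on_arr F (Ident A x) = Ident B (on_obj F x)"
    and on_comp: "f \<in> Hom A x y \<Longrightarrow> g \<in> Hom A y z \<Longrightarrow>
      on_arr F (Comp A g f) = Comp B (on_arr F g) (on_arr F f)"

definition prod_cat :: "('o, 'm) cat \<Rightarrow> ('p, 'n) cat \<Rightarrow> ('o \<times> 'p, 'm \<times> 'n) cat" where
  "prod_cat A B =
    \<lparr> Obj = Obj A \<times> Obj B,
      Arr = Arr A \<times> Arr B,
      Dom = (\<lambda>(f, g). (Dom A f, Dom B g)),
      Cod = (\<lambda>(f, g). (Cod A f, Cod B g)),
      Ident = (\<lambda>(x, y). (Ident A x, Ident B y)),
      Comp = (\<lambda>(g, g') (f, f'). (Comp A g f, Comp B g' f')) \<rparr>"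

definition discrete_cat :: "'m set \<Rightarrow> ('m, 'm) cat" where
  "discrete_cat X =
    \<lparr> Obj = X, Arr = X, Dom = (\<lambda>x. x), Cod = (\<lambda>x. x), Ident = (\<lambda>x. x), Comp = (\<lambda>g f. f) \<rparr>"

text \<open>
  A strict 2-category is a category enriched in categories.  Horizontal composition
  \<open>hcomp T x y z\<close> is a functor \<open>T(y,z) \<times> T(x,y) \<rightarrow> T(x,z)\<close>.
\<close>

record ('o, 'f, 'a) two_cat =
  Ob :: "'o set"
  hom :: "'o \<Rightarrow> 'o \<Rightarrow> ('f, 'a) cat"
  unit1 :: "'o \<Rightarrow> 'f"
  hcomp :: "'o \<Rightarrow> 'o \<Rightarrow> 'o \<Rightarrow> ('f \<times> 'f, 'a \<times> 'a, 'f, 'a) func"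

definition comp1 :: "('o, 'f, 'a) two_cat \<Rightarrow> 'o \<Rightarrow> 'o \<Rightarrow> 'o \<Rightarrow> 'f \<Rightarrow> 'f \<Rightarrow> 'f" where
  "comp1 T x y z g f = on_obj (hcomp T x y z) (g, f)"

definition comp2 :: "('o, 'f, 'a) two_cat \<Rightarrow> 'o \<Rightarrow> 'o \<Rightarrow> 'o \<Rightarrow> 'a \<Rightarrow> 'a \<Rightarrow> 'a" where
  "comp2 T x y z \<beta> \<alpha> = on_arr (hcomp T x y z) (\<beta>, \<alpha>)"

locale two_category =
  fixes T :: "('o, 'f, 'a) two_cat"
  assumes hom_category: "x \<in> Ob T \<Longrightarrow> y \<in> Ob T \<Longrightarrow> category (hom T x y)"
    and unit1_obj: "x \<in> Ob T \<Longrightarrow> unit1 T x \<in> Obj (hom T x x)"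
    and hcomp_functor: "x \<in> Ob T \<Longrightarrow> y \<in> Ob T \<Longrightarrow> z \<in> Ob T \<Longrightarrow>
      is_functor (prod_cat (hom T y z) (hom T x y)) (hom T x z) (hcomp T x y z)"
    and comp1_assoc: "x \<in> Ob T \<Longrightarrow> y \<in> Ob T \<Longrightarrow> z \<in> Ob T \<Longrightarrow> w \<in> Ob T \<Longrightarrow>
      f \<in> Obj (hom T x y) \<Longrightarrow> g \<in> Obj (hom T y z) \<Longrightarrow> h \<in> Obj (hom T z w) \<Longrightarrow>
      comp1 T x z w h (comp1 T x y z g f) = comp1 T x y w (comp1 T y z w h g) f"
    and comp2_assoc: "x \<in> Ob T \<Longrightarrow> y \<in> Ob T \<Longrightarrow> z \<in> Ob T \<Longrightarrow> w \<in> Ob T \<Longrightarrow>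
      \<alpha> \<in> Arr (hom T x y) \<Longrightarrow> \<beta> \<in> Arr (hom T y z) \<Longrightarrow> \<gamma> \<in> Arr (hom T z w) \<Longrightarrow>
      comp2 T x z w \<gamma> (comp2 T x y z \<beta> \<alpha>) = comp2 T x y w (comp2 T y z w \<gamma> \<beta>) \<alpha>"
    and comp1_unit: "x \<in> Ob T \<Longrightarrow> y \<in> Ob T \<Longrightarrow> f \<in> Obj (hom T x y) \<Longrightarrow>
      comp1 T x x y f (unit1 T x) = f"
    and unit_comp1: "x \<in> Ob T \<Longrightarrow> y \<in> Ob T \<Longrightarrow> f \<in> Obj (hom T x y) \<Longrightarrow>
      comp1 T x y y (unit1 T y) f = f"
    and comp2_unit: "x \<in> Ob T \<Longrightarrow> y \<in> Ob T \<Longrightarrow> \<alpha> \<in> Arr (hom T x y) \<Longrightarrow>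
      comp2 T x x y \<alpha> (Ident (hom T x x) (unit1 T x)) = \<alpha>"
    and unit_comp2: "x \<in> Ob T \<Longrightarrow> y \<in> Ob T \<Longrightarrow> \<alpha> \<in> Arr (hom T x y) \<Longrightarrow>
      comp2 T x y y (Ident (hom T y y) (unit1 T y)) \<alpha> = \<alpha>"

text \<open>Whiskering of a 2-morphism \<open>\<alpha>\<close> in \<open>T(y,z)\<close> with \<open>G : x \<rightarrow> y\<close>, written \<open>\<alpha> \<cdot> G\<close>.\<close>

definition whisker :: "('o, 'f, 'a) two_cat \<Rightarrow> 'o \<Rightarrow> 'o \<Rightarrow> 'o \<Rightarrow> 'a \<Rightarrow> 'f \<Rightarrow> 'a" where
  "whisker T x y z \<alpha> G = comp2 T x y z \<alpha> (Ident (hom T x y) G)"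

text \<open>The precomposition functor \<open>T(G,z) : T(y,z) \<rightarrow> T(x,z)\<close> for \<open>G : x \<rightarrow> y\<close>.\<close>

definition precomp ::
  "('o, 'f, 'a) two_cat \<Rightarrow> 'o \<Rightarrow> 'o \<Rightarrow> 'o \<Rightarrow> 'f \<Rightarrow> ('f, 'a, 'f, 'a) func" where
  "precomp T x y z G =
    \<lparr> on_obj = (\<lambda>H. comp1 T x y z H G), on_arr = (\<lambda>\<alpha>. whisker T x y z \<alpha> G) \<rparr>"

text \<open>
  \<open>(L, \<eta>)\<close> is a left Kan extension of \<open>K : c \<rightarrow> e\<close> along \<open>G : c \<rightarrow> d'\<close>.  Only the existence of
  the comparison 2-morphism is required here, not its uniqueness.
\<close>

definition left_Kan_extension ::
  "('o, 'f, 'a) two_cat \<Rightarrow> 'o \<Rightarrow> 'o \<Rightarrow> 'o \<Rightarrow> 'f \<Rightarrow> 'f \<Rightarrow> 'f \<Rightarrow> 'a \<Rightarrow> bool" where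
  "left_Kan_extension T c d' e K G L \<eta> \<longleftrightarrow>
    L \<in> Obj (hom T d' e) \<and>
    \<eta> \<in> Hom (hom T c e) K (comp1 T c d' e L G) \<and>
    (\<forall>H \<in> Obj (hom T d' e). \<forall>\<gamma> \<in> Hom (hom T c e) K (comp1 T c d' e H G).
      \<exists>\<alpha> \<in> Hom (hom T d' e) L H. \<gamma> = Comp (hom T c e) (whisker T c d' e \<alpha> G) \<eta>)"

definition locally_discrete :: "('o, 'm) cat \<Rightarrow> ('o, 'm, 'm) two_cat" where
  "locally_discrete D =
    \<lparr> Ob = Obj D,
      hom = (\<lambda>x y. discrete_cat (Hom D x y)),
      unit1 = Ident D,
      hcomp = (\<lambda>x y z. \<lparr> on_obj = (\<lambda>(g, f). Comp D g f), on_arr = (\<lambda>(g, f). Comp D g f) \<rparr>) \<rparr>"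

record ('o, 'f, 'a, 'p, 'g, 'b) lax_func =
  lf_obj :: "'o \<Rightarrow> 'p"
  lf_hom :: "'o \<Rightarrow> 'o \<Rightarrow> ('f, 'a, 'g, 'b) func"
  lf_comp :: "'o \<Rightarrow> 'o \<Rightarrow> 'o \<Rightarrow> 'f \<Rightarrow> 'f \<Rightarrow> 'b"   (* F(g) F(f) \<Rightarrow> F(g f) *)
  lf_unit :: "'o \<Rightarrow> 'b"                        (* Id \<Rightarrow> F(Id) *)

locale lax_functor =
  fixes A :: "('o, 'f, 'a) two_cat" and B :: "('p, 'g, 'b) two_cat"
    and F :: "('o, 'f, 'a, 'p, 'g, 'b) lax_func"
  assumes source: "two_category A"
    and target: "two_category B"
    and obj: "x \<in> Ob A \<Longrightarrow> lf_obj F x \<in> Ob B"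
    and hom_functor: "x \<in> Ob A \<Longrightarrow> y \<in> Ob A \<Longrightarrow>
      is_functor (hom A x y) (hom B (lf_obj F x) (lf_obj F y)) (lf_hom F x y)"
    and comp_cell: "x \<in> Ob A \<Longrightarrow> y \<in> Ob A \<Longrightarrow> z \<in> Ob A \<Longrightarrow>
      f \<in> Obj (hom A x y) \<Longrightarrow> g \<in> Obj (hom A y z) \<Longrightarrow>
      lf_comp F x y z g f \<in> Hom (hom B (lf_obj F x) (lf_obj F z))
        (comp1 B (lf_obj F x) (lf_obj F y) (lf_obj F z)
          (on_obj (lf_hom F y z) g) (on_obj (lf_hom F x y) f))
        (on_obj (lf_hom F x z) (comp1 A x y z g f))"
    and unit_cell: "x \<in> Ob A \<Longrightarrow>
      lf_unit F x \<in> Hom (hom B (lf_obj F x) (lf_obj F x))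
        (unit1 B (lf_obj F x)) (on_obj (lf_hom F x x) (unit1 A x))"
    and comp_natural: "x \<in> Ob A \<Longrightarrow> y \<in> Ob A \<Longrightarrow> z \<in> Ob A \<Longrightarrow>
      \<alpha> \<in> Hom (hom A x y) f f' \<Longrightarrow> \<beta> \<in> Hom (hom A y z) g g' \<Longrightarrow>
      Comp (hom B (lf_obj F x) (lf_obj F z))
        (lf_comp F x y z g' f')
        (comp2 B (lf_obj F x) (lf_obj F y) (lf_obj F z)
          (on_arr (lf_hom F y z) \<beta>) (on_arr (lf_hom F x y) \<alpha>)) =
      Comp (hom B (lf_obj F x) (lf_obj F z))
        (on_arr (lf_hom F x z) (comp2 A x y z \<beta> \<alpha>))
        (lf_comp F x y z g f)"
    and comp_coherence: "x \<in> Ob A \<Longrightarrow> y \<in> Ob A \<Longrightarrow> z \<in> Ob A \<Longrightarrow> w \<in> Ob A \<Longrightarrow>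
      f \<in> Obj (hom A x y) \<Longrightarrow> g \<in> Obj (hom A y z) \<Longrightarrow> h \<in> Obj (hom A z w) \<Longrightarrow>
      Comp (hom B (lf_obj F x) (lf_obj F w))
        (lf_comp F x z w h (comp1 A x y z g f))
        (comp2 B (lf_obj F x) (lf_obj F z) (lf_obj F w)
          (Ident (hom B (lf_obj F z) (lf_obj F w)) (on_obj (lf_hom F z w) h))
          (lf_comp F x y z g f)) =
      Comp (hom B (lf_obj F x) (lf_obj F w))
        (lf_comp F x y w (comp1 A y z w h g) f)
        (comp2 B (lf_obj F x) (lf_obj F y) (lf_obj F w)
          (lf_comp F y z w h g)
          (Ident (hom B (lf_obj F x) (lf_obj F y)) (on_obj (lf_hom F x y) f)))"
    and unit_coherence_right: "x \<in> Ob A \<Longrightarrow> y \<in> Ob A \<Longrightarrow> f \<in> Obj (hom A x y) \<Longrightarrow>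
      Comp (hom B (lf_obj F x) (lf_obj F y))
        (lf_comp F x x y f (unit1 A x))
        (comp2 B (lf_obj F x) (lf_obj F x) (lf_obj F y)
          (Ident (hom B (lf_obj F x) (lf_obj F y)) (on_obj (lf_hom F x y) f))
          (lf_unit F x)) =
      Ident (hom B (lf_obj F x) (lf_obj F y)) (on_obj (lf_hom F x y) f)"
    and unit_coherence_left: "x \<in> Ob A \<Longrightarrow> y \<in> Ob A \<Longrightarrow> f \<in> Obj (hom A x y) \<Longrightarrow>
      Comp (hom B (lf_obj F x) (lf_obj F y))
        (lf_comp F x y y (unit1 A y) f)
        (comp2 B (lf_obj F x) (lf_obj F y) (lf_obj F y)
          (lf_unit F y)
          (Ident (hom B (lf_obj F x) (lf_obj F y)) (on_obj (lf_hom F x y) f))) =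
      Ident (hom B (lf_obj F x) (lf_obj F y)) (on_obj (lf_hom F x y) f)"

locale monoidal_preorder = two_category S
  for S :: "('p, 'g, 'b) two_cat" and pt :: 'p +
  assumes single_object: "Ob S = {pt}"
    and thin: "\<theta> \<in> Hom (hom S pt pt) a b \<Longrightarrow> \<theta>' \<in> Hom (hom S pt pt) a b \<Longrightarrow> \<theta> = \<theta>'"

definition mp_le :: "('p, 'g, 'b) two_cat \<Rightarrow> 'p \<Rightarrow> 'g \<Rightarrow> 'g \<Rightarrow> bool" where
  "mp_le S pt a b \<longleftrightarrow> (\<exists>\<theta>. \<theta> \<in> Hom (hom S pt pt) a b)"

definition is_bottom :: "('p, 'g, 'b) two_cat \<Rightarrow> 'p \<Rightarrow> 'g \<Rightarrow> bool" where
  "is_bottom S pt b \<longleftrightarrow> b \<in> Obj (hom S pt pt) \<and> (\<forall>a \<in> Obj (hom S pt pt). mp_le S pt b a)"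

locale flavoured_error = monoidal_preorder S pt + category D
  for S :: "('p, 'g, 'b) two_cat" and pt :: 'p
    and D :: "('o, 'm) cat" and Err :: "('o, 'm, 'm, 'p, 'g, 'b) lax_func" +
  assumes unit_bottom: "is_bottom S pt (unit1 S pt)"
    and lax: "lax_functor (locally_discrete D) S Err"

definition err_of ::
  "('o, 'm) cat \<Rightarrow> ('o, 'm, 'm, 'p, 'g, 'b) lax_func \<Rightarrow> 'm \<Rightarrow> 'g" where
  "err_of D Err f = on_obj (lf_hom Err (Dom D f) (Cod D f)) f"

text \<open>\<open>err_le S pt D Err x y z w\<close> is the comparison \<open>Err(x,y) \<le>\<^sub>S Err(z,w)\<close>.\<close>

definition err_le ::
  "('p, 'g, 'b) two_cat \<Rightarrow> 'p \<Rightarrow> ('o, 'm) cat \<Rightarrow> ('o, 'm, 'm, 'p, 'g, 'b) lax_func \<Rightarrow>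
    'o \<Rightarrow> 'o \<Rightarrow> 'o \<Rightarrow> 'o \<Rightarrow> bool" where
  "err_le S pt D Err x y z w \<longleftrightarrow>
    (\<forall>f \<in> Hom D z w. \<exists>g \<in> Hom D x y. mp_le S pt (err_of D Err g) (err_of D Err f))"

definition global_error_minimiser ::
  "('p, 'g, 'b) two_cat \<Rightarrow> 'p \<Rightarrow> ('o, 'm) cat \<Rightarrow> ('o, 'm, 'm, 'p, 'g, 'b) lax_func \<Rightarrow>
    ('q, 'n) cat \<Rightarrow> ('q, 'n, 'o, 'm) func \<Rightarrow> 'o \<Rightarrow> 'q \<Rightarrow> bool" where
  "global_error_minimiser S pt D Err M J d x \<longleftrightarrow>
    x \<in> Obj M \<and> (\<forall>m \<in> Obj M. err_le S pt D Err d (on_obj J x) d (on_obj J m))"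

end

(* A cell d \<Rightarrow> m\<iota> factors as (\<alpha>\<cdot>\<iota>)\<eta>, and precomposing with \<eta> never costs more than the composite:
   Err(\<eta>) = Id Err(\<eta>) \<le> Err(\<alpha>\<cdot>\<iota>) Err(\<eta>) \<le> Err((\<alpha>\<cdot>\<iota>)\<eta>), since Id is a bottom element and Err is lax.
   So \<eta> itself witnesses every comparison. *)
theory Submission
  imports Defs
begin

text \<open>Functoriality of \<open>hcomp\<close>, applied to the pair (\<open>\<beta>\<close>,
  \<open>\<alpha>\<close>) seen as one arrow of the product category.\<close>

lemma (in two_category) comp2_hom:
  assumes "x \<in> Ob T" "y \<in> Ob T" "z \<in> Ob T"
    and "\<alpha> \<in> Hom (hom T x y) f f'" "\<beta> \<in> Hom (hom T y z) g g'"
  shows "comp2 T x y z \<beta> \<alpha> \<in> Hom (hom T x z) (comp1 T x y z g f) (comp1 T x y z g' f')"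
  using is_functor.on_hom[OF hcomp_functor[OF assms(1-3)], of "(\<beta>, \<alpha>)" "(g, f)" "(g', f')"]
    assms(4,5)
  by (simp add: comp1_def comp2_def prod_cat_def Hom_def)

lemma (in two_category) whisker_hom:
  assumes "x \<in> Ob T" "y \<in> Ob T" "z \<in> Ob T"
    and "G \<in> Obj (hom T x y)" "\<alpha> \<in> Hom (hom T y z) H H'"
  shows "whisker T x y z \<alpha> G \<in> Hom (hom T x z) (comp1 T x y z H G) (comp1 T x y z H' G)"
  unfolding whisker_def
  using assms category.ident_hom[OF hom_category] by (blast intro: comp2_hom)

lemma (in monoidal_preorder) mp_le_trans:
  assumes "mp_le S pt a b" "mp_le S pt b c"
  shows "mp_le S pt a c"
  using assms category.comp_hom[OF hom_category, of pt pt] single_object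
  unfolding mp_le_def by blast

text \<open>Monotonicity comes from the 2-categorical structure: whiskering the 2-morphism that
  witnesses \<open>a\<close> \<le> \<open>b\<close> with \<open>c\<close> gives the required
  one.\<close>

lemma (in monoidal_preorder) mp_le_comp1_right:
  assumes "mp_le S pt a b" "c \<in> Obj (hom S pt pt)"
  shows "mp_le S pt (comp1 S pt pt pt a c) (comp1 S pt pt pt b c)"
  using assms whisker_hom[of pt pt pt] single_object unfolding mp_le_def by blast

context flavoured_error
begin

text \<open>Allows every hom-category of \<open>S\<close> occurring in the lax functor axioms to be
  rewritten as \<open>hom S pt pt\<close>.\<close>

lemma lf_obj_eq: "x \<in> Obj D \<Longrightarrow> lf_obj Err x = pt"
  using lax_functor.obj[OF lax, of x] single_object by (simp add: locally_discrete_def)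

lemma err_of_obj:
  assumes "f \<in> Hom D x y"
  shows "err_of D Err f \<in> Obj (hom S pt pt)"
proof -
  have xy: "Dom D f = x" "Cod D f = y" "x \<in> Obj D" "y \<in> Obj D"
    using assms dom_obj cod_obj by (auto simp: Hom_def)
  \<comment> \<open>In the locally discrete 2-category the morphisms of \<open>D\<close> are the
    objects of the hom-categories, so \<open>f\<close> is sent to a 1-morphism of
    \<open>S\<close>.\<close>
  have "is_functor (discrete_cat (Hom D x y)) (hom S pt pt) (lf_hom Err x y)"
    using lax_functor.hom_functor[OF lax, of x y] xy
    by (simp add: locally_discrete_def lf_obj_eq)
  then show ?thesis
    using is_functor.on_obj[of _ _ _ f] assms xy
    by (fastforce simp: err_of_def discrete_cat_def)
qed

text \<open>The laxity cell \<open>lf_comp\<close> is the witnessing 2-morphism.\<close>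

lemma err_of_comp:
  assumes "f \<in> Hom D x y" "g \<in> Hom D y z"
  shows "mp_le S pt (comp1 S pt pt pt (err_of D Err g) (err_of D Err f)) (err_of D Err (Comp D g f))"
proof -
  \<comment> \<open>\<open>err_of\<close> reads its hom-category off the endpoints of its argument,
    so those of the composite must be known.\<close>
  have gf: "Comp D g f \<in> Hom D x z"
    using assms by (rule comp_hom)
  have "x \<in> Obj D" "y \<in> Obj D" "z \<in> Obj D"
    using assms dom_obj cod_obj by (auto simp: Hom_def)
  then have "lf_comp Err x y z g f \<in> Hom (hom S pt pt)
      (comp1 S pt pt pt (on_obj (lf_hom Err y z) g) (on_obj (lf_hom Err x y) f))
      (on_obj (lf_hom Err x z) (Comp D g f))"
    using lax_functor.comp_cell[OF lax, of x y z f g] assms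
    by (simp add: locally_discrete_def discrete_cat_def comp1_def lf_obj_eq)
  then show ?thesis
    using assms gf by (auto simp: mp_le_def err_of_def Hom_def)
qed

lemma err_of_le_comp:
  assumes "f \<in> Hom D x y" "g \<in> Hom D y z"
  shows "mp_le S pt (err_of D Err f) (err_of D Err (Comp D g f))"
proof -
  have "mp_le S pt (unit1 S pt) (err_of D Err g)"
    using unit_bottom err_of_obj[OF assms(2)] by (simp add: is_bottom_def)
  then have "mp_le S pt (comp1 S pt pt pt (unit1 S pt) (err_of D Err f))
      (comp1 S pt pt pt (err_of D Err g) (err_of D Err f))"
    using err_of_obj[OF assms(1)] by (rule mp_le_comp1_right)
  \<comment> \<open>The left unit law of \<open>S\<close> removes the factor
    \<open>unit1 S pt\<close>.\<close>
  then have "mp_le S pt (err_of D Err f) (comp1 S pt pt pt (err_of D Err g) (err_of D Err f))"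
    using unit_comp1 err_of_obj[OF assms(1)] single_object by simp
  then show ?thesis
    using err_of_comp[OF assms] by (rule mp_le_trans)
qed

end

theorem theorem3p15:
  fixes T :: "('o, 'f, 'a) two_cat"
    and \<delta> \<mu> \<tau> :: 'o
    and \<iota> d L :: 'f
    and \<eta> :: 'a
    and S :: "('p, 'g, 'b) two_cat"
    and pt :: 'p
    and Err :: "('f, 'a, 'a, 'p, 'g, 'b) lax_func"
  assumes "two_category T"
    and "\<delta> \<in> Ob T" and "\<mu> \<in> Ob T" and "\<tau> \<in> Ob T"
    and "\<iota> \<in> Obj (hom T \<delta> \<mu>)" and "d \<in> Obj (hom T \<delta> \<tau>)"
    and "monoidal_preorder S pt"
    and "is_bottom S pt (unit1 S pt)"
    and "flavoured_error S pt (hom T \<delta> \<tau>) Err"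
    and "left_Kan_extension T \<delta> \<mu> \<tau> d \<iota> L \<eta>"
  shows "global_error_minimiser S pt (hom T \<delta> \<tau>) Err (hom T \<mu> \<tau>) (precomp T \<delta> \<mu> \<tau> \<iota>) d L"
proof -
  let ?D = "hom T \<delta> \<tau>" and ?Inf = "\<lambda>m. comp1 T \<delta> \<mu> \<tau> m \<iota>"
  interpret T: two_category T by fact
  interpret E: flavoured_error S pt ?D Err by fact
  have L: "L \<in> Obj (hom T \<mu> \<tau>)" and \<eta>: "\<eta> \<in> Hom ?D d (?Inf L)"
    using assms(10) by (auto simp: left_Kan_extension_def)
  have "\<exists>g \<in> Hom ?D d (?Inf L). mp_le S pt (err_of ?D Err g) (err_of ?D Err \<gamma>)"
    if m: "m \<in> Obj (hom T \<mu> \<tau>)" and \<gamma>: "\<gamma> \<in> Hom ?D d (?Inf m)" for m \<gamma>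
  proof -
    \<comment> \<open>A morphism \<open>\<gamma>\<close> of \<open>?D\<close> from \<open>d\<close>
      to \<open>?Inf m\<close> is a 2-morphism of \<open>T\<close>, so (\<open>m\<close>,
      \<open>\<gamma>\<close>) is a competing pair for the Kan extension.\<close>
    obtain \<alpha> where \<alpha>: "\<alpha> \<in> Hom (hom T \<mu> \<tau>) L m"
      and eq: "\<gamma> = Comp ?D (whisker T \<delta> \<mu> \<tau> \<alpha> \<iota>) \<eta>"
      using assms(10) m \<gamma> unfolding left_Kan_extension_def by blast
    have "whisker T \<delta> \<mu> \<tau> \<alpha> \<iota> \<in> Hom ?D (?Inf L) (?Inf m)"
      using assms(2-5) \<alpha> by (rule T.whisker_hom)
    then have "mp_le S pt (err_of ?D Err \<eta>) (err_of ?D Err \<gamma>)"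
      \<comment> \<open>Here \<open>\<eta>\<close> is the first factor and the whiskered
        \<open>\<alpha>\<close> the second, whose error can only add to that of
        \<open>\<eta>\<close>.\<close>
      unfolding eq by (rule E.err_of_le_comp[OF \<eta>])
    then show ?thesis using \<eta> by blast
  qed
  then show ?thesis
    using L by (simp add: global_error_minimiser_def err_le_def precomp_def)
qed

end
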